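(* Let $X=(X_t)_{t\ge 0}$ be a real-valued additive process with $X_0=0$ satisfying $\mathbf{E}(e^{-\lambda X_t})<\infty$ for all $t\ge 0$ and all $\lambda\ge 0$. For $t\ge 0$ and $\lambda\ge 0$ put $\Phi(t;\lambda):=-\log \mathbf{E}(e^{-\lambda X_t})$. If for all $n\in\{1,2,\dots\}$ $$\int_0^{\infty} e^{-\left(\Phi(s;n)-\Phi(s;n-1)\right)}\,ds<\infty,$$ then the random variable $I_\infty:=\int_0^\infty e^{-X_u}\,du$ has all positive moments, i.e. $\mathbf{E}(I_\infty^{\alpha})<\infty$ for every $\alpha>0$.
   Context: A real-valued additive process is a real-valued stochastic process $X=(X_t)_{t\ge0}$ with $X_0=0$ a.s., with independent increments (not necessarily stationary), with càdlàg sample paths, and continuous in probability. The random variable $I_\infty$ is a priori $[0,\infty]$-valued. *)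

theory Defs
  imports "HOL-Probability.Probability"
begin

text \<open>Right-continuity and left limits are required on the time domain $[0,\infty)$ only.\<close>

definition cadlag :: "(real \<Rightarrow> real) \<Rightarrow> bool" where
  "cadlag f \<longleftrightarrow>
     (\<forall>t\<ge>0. continuous (at_right t) f) \<and> (\<forall>t>0. \<exists>l. (f \<longlongrightarrow> l) (at_left t))"

text \<open>Time ranges over the nonnegative reals; values of the process at negative times are
  unconstrained and never used. In the increment condition the first partition point may be 0.\<close>

locale additive_process = prob_space M for M :: "'a measure" +
  fixes X :: "real \<Rightarrow> 'a \<Rightarrow> real"
  assumes process_measurable: "\<And>t. t \<ge> 0 \<Longrightarrow> random_variable borel (X t)"
    and start_zero: "AE \<omega> in M. X 0 \<omega> = 0"
    and independent_increments:
      "\<And>(n::nat) (\<tau>::nat \<Rightarrow> real). \<lbrakk>0 \<le> \<tau> 0; strict_mono_on {..n} \<tau>\<rbrakk> \<Longrightarrow>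
         indep_vars (\<lambda>_. borel) (\<lambda>k \<omega>. X (\<tau> (Suc k)) \<omega> - X (\<tau> k) \<omega>) {..<n}"
    and cadlag_paths: "\<And>\<omega>. \<omega> \<in> space M \<Longrightarrow> cadlag (\<lambda>t. X t \<omega>)"
    and continuous_in_probability:
      "\<And>t \<epsilon>. \<lbrakk>t \<ge> 0; \<epsilon> > 0\<rbrakk> \<Longrightarrow>
         ((\<lambda>s. prob {\<omega> \<in> space M. \<bar>X s \<omega> - X t \<omega>\<bar> > \<epsilon>}) \<longlongrightarrow> 0) (at t within {0..})"

definition laplace_exponent :: "'a measure \<Rightarrow> (real \<Rightarrow> 'a \<Rightarrow> real) \<Rightarrow> real \<Rightarrow> real \<Rightarrow> real" where
  "laplace_exponent M X t l = - ln (\<integral>\<omega>. exp (- l * X t \<omega>) \<partial>M)"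

definition exp_functional :: "(real \<Rightarrow> 'a \<Rightarrow> real) \<Rightarrow> 'a \<Rightarrow> ennreal" where
  "exp_functional X \<omega> = (\<integral>\<^sup>+u\<in>{0..}. ennreal (exp (- X u \<omega>)) \<partial>lborel)"

text \<open>Powers with positive real exponent on the extended nonnegative reals, which the library
  provides only for natural exponents. The value at infinity is infinite; only positive exponents
  are meaningful.\<close>

definition ennreal_powr :: "ennreal \<Rightarrow> real \<Rightarrow> ennreal" where
  "ennreal_powr x a = (if x = \<infinity> then \<infinity> else ennreal (enn2real x powr a))"

end

theory Submission
  imports Defs
begin

text \<open>Ordering the integration variables gives
  $I_\infty^n = n! \int_{0<s_1<\dots<s_n} e^{-X_{s_1}-\dots-X_{s_n}}$. Since
  $X_{s_1}+\dots+X_{s_n} = \sum_k (n-k+1)(X_{s_k}-X_{s_{k-1}})$ with $s_0=0$, independence of the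
  increments turns the expectation of the integrand into the product of the factors
  $e^{-(\Phi(s_k;n-k+1)-\Phi(s_k;n-k))}$. Dropping the ordering constraint bounds
  $\mathbf{E}(I_\infty^n)$ by $n!$ times the product of the $n$ integrals in the hypothesis.\<close>

section \<open>Powers of tail integrals as ordered integrals\<close>

text \<open>Recursion on the lower limit makes each unfolding append one time to the right of those
  already chosen, which matches the way partitions are extended further on.\<close>

fun simplex_integral :: "(real \<Rightarrow> ennreal) \<Rightarrow> nat \<Rightarrow> real \<Rightarrow> ennreal" where
  "simplex_integral f 0 t = 1"
| "simplex_integral f (Suc n) t =
     (\<integral>\<^sup>+s. f s * simplex_integral f n s * indicator {t<..} s \<partial>lborel)"

text \<open>Exchanging expectation and time integration by Fubini calls for measurability jointly in
  the lower limit and the random parameter.\<close>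

lemma measurable_simplex_integral_param:
  assumes [measurable]: "(\<lambda>(u, \<omega>). f \<omega> u) \<in> borel_measurable (borel \<Otimes>\<^sub>M M)"
  shows "(\<lambda>(t, \<omega>). simplex_integral (f \<omega>) n t) \<in> borel_measurable (borel \<Otimes>\<^sub>M M)"
proof (induction n)
  case (Suc n)
  note [measurable] = Suc
  have [measurable]: "Measurable.pred ((borel \<Otimes>\<^sub>M M) \<Otimes>\<^sub>M borel) (\<lambda>x. snd x \<in> {fst (fst x)::real<..})"
    unfolding greaterThan_iff by measurable
  show ?case
    by (simp add: case_prod_beta') measurable
qed simp

lemma measurable_simplex_integral [measurable]:
  assumes [measurable]: "f \<in> borel_measurable borel"
  shows "simplex_integral f n \<in> borel_measurable borel"
proof -
  \<comment> \<open>A one-point parameter space reduces the deterministic case to the parametrised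
    one.\<close>
  have "(\<lambda>(u, x). f u) \<in> borel_measurable (borel \<Otimes>\<^sub>M (count_space {()}))"
    by measurable
  from measurable_simplex_integral_param[of "\<lambda>_. f", OF this]
  have "(\<lambda>t. (\<lambda>(t, x). simplex_integral f n t) (t, ())) \<in> borel_measurable borel"
    by (rule measurable_compose[rotated]) simp
  then show ?thesis by simp
qed

text \<open>Formally \<open>f s * I s ^ n\<close> is the derivative of
  \<open>- I s ^ Suc n / Suc n\<close>, but \<open>I\<close> may be infinite, so only addition and
  Fubini are used. In \<open>I t * A n t\<close> the variable of the first factor lies below or
  above the variable \<open>u\<close> of the second; the two cases contribute \<open>B\<close> and
  \<open>A (Suc n) t\<close>, and the induction hypothesis links these two.\<close>

lemma tail_integral_power_step:
  fixes f :: "real \<Rightarrow> ennreal" and t :: real and n :: nat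
  defines "I \<equiv> \<lambda>t. \<integral>\<^sup>+s. f s * indicator {t<..} s \<partial>lborel"
  defines "A \<equiv> \<lambda>n t. \<integral>\<^sup>+s. f s * I s ^ n * indicator {t<..} s \<partial>lborel"
  assumes f [measurable]: "f \<in> borel_measurable borel"
  shows "of_nat (Suc n) * A n t = I t ^ Suc n"
proof (induction n arbitrary: t)
  case 0
  then show ?case by (simp add: A_def I_def)
next
  case (Suc n)
  have I_m [measurable]: "I \<in> borel_measurable borel"
  proof -
    have "I = simplex_integral f (Suc 0)"
      by (simp add: I_def fun_eq_iff)
    then show ?thesis by simp
  qed
  have [measurable]: "Measurable.pred (borel \<Otimes>\<^sub>M borel) (\<lambda>x. snd x \<in> {fst x::real<..})"
    "Measurable.pred (borel \<Otimes>\<^sub>M borel) (\<lambda>x. fst x \<in> {snd x::real<..})"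
    "\<And>s::real. Measurable.pred (borel \<Otimes>\<^sub>M borel) (\<lambda>x. snd x \<in> {s<..<fst x})"
    unfolding greaterThan_iff greaterThanLessThan_iff by measurable
  \<comment> \<open>This is the double integral over \<open>t < s < u\<close>, with the power of
    \<open>I\<close> attached to the larger variable.\<close>
  define B where "B = (\<integral>\<^sup>+u. f u * I u ^ n * indicator {t<..} u *
      (\<integral>\<^sup>+s. f s * indicator {t<..<u} s \<partial>lborel) \<partial>lborel)"
  have split: "I t = (\<integral>\<^sup>+s. f s * indicator {t<..<u} s \<partial>lborel) + I u" if "t < u" for u
  proof -
    have "I t = (\<integral>\<^sup>+s. f s * indicator {t<..<u} s + f s * indicator {u<..} s \<partial>lborel)"
      unfolding I_def
      by (rule nn_integral_cong_AE, rule AE_mp[OF AE_lborel_singleton[of u]])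
        (use that in \<open>auto split: split_indicator\<close>)
    then show ?thesis
      by (simp add: nn_integral_add I_def)
  qed
  \<comment> \<open>The induction hypothesis is read backwards at every inner point
    \<open>s\<close>, trading a power of \<open>I s\<close> for one more integral; hence
    \<open>t\<close> is arbitrary in the induction.\<close>
  have "A (Suc n) t = (\<integral>\<^sup>+s. f s * (of_nat (Suc n) * A n s) * indicator {t<..} s \<partial>lborel)"
    unfolding Suc by (simp only: A_def)
  also have "\<dots> = of_nat (Suc n) * (\<integral>\<^sup>+s. f s * A n s * indicator {t<..} s \<partial>lborel)"
    by (subst nn_integral_cmult[symmetric])
      (auto simp: A_def ac_simps simp del: of_nat_Suc)
  also have "(\<integral>\<^sup>+s. f s * A n s * indicator {t<..} s \<partial>lborel) =
      (\<integral>\<^sup>+s. \<integral>\<^sup>+u. f s * indicator {t<..} s * (f u * I u ^ n * indicator {s<..} u)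
        \<partial>lborel \<partial>lborel)"
    by (intro nn_integral_cong, subst nn_integral_cmult) (measurable, simp add: A_def ac_simps)
  also have "\<dots> = (\<integral>\<^sup>+u. \<integral>\<^sup>+s. f s * indicator {t<..} s * (f u * I u ^ n * indicator {s<..} u)
        \<partial>lborel \<partial>lborel)"
    by (rule lborel_pair.Fubini') (simp add: case_prod_beta')
  also have "\<dots> = B"
    unfolding B_def
  proof (rule nn_integral_cong)
    fix u :: real
    have "(\<integral>\<^sup>+s. f s * indicator {t<..} s * (f u * I u ^ n * indicator {s<..} u) \<partial>lborel) =
      (\<integral>\<^sup>+s. f u * I u ^ n * indicator {t<..} u * (f s * indicator {t<..<u} s) \<partial>lborel)"
      by (intro nn_integral_cong) (auto split: split_indicator simp: ac_simps)
    then show "(\<integral>\<^sup>+s. f s * indicator {t<..} s * (f u * I u ^ n * indicator {s<..} u) \<partial>lborel) =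
      f u * I u ^ n * indicator {t<..} u * (\<integral>\<^sup>+s. f s * indicator {t<..<u} s \<partial>lborel)"
      by (simp add: nn_integral_cmult)
  qed
  finally have A_B: "A (Suc n) t = of_nat (Suc n) * B" .
  have "I t * A n t = (\<integral>\<^sup>+u. I t * (f u * I u ^ n * indicator {t<..} u) \<partial>lborel)"
    by (simp add: A_def nn_integral_cmult)
  also have "\<dots> = (\<integral>\<^sup>+u. f u * I u ^ n * indicator {t<..} u *
      (\<integral>\<^sup>+s. f s * indicator {t<..<u} s \<partial>lborel) + f u * I u ^ Suc n * indicator {t<..} u \<partial>lborel)"
    by (intro nn_integral_cong)
      (auto split: split_indicator simp: split distrib_left distrib_right ac_simps)
  also have "\<dots> = B + A (Suc n) t"
    unfolding B_def A_def by (rule nn_integral_add) (measurable, measurable)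
  \<comment> \<open>Scaling by \<open>Suc n\<close> turns \<open>B\<close> into
    \<open>A (Suc n) t\<close> and avoids a subtraction, which infinite values would spoil.\<close>
  finally have "of_nat (Suc n) * (I t * A n t) = A (Suc n) t + of_nat (Suc n) * A (Suc n) t"
    using A_B by (simp only: distrib_left)
  also have "\<dots> = of_nat (Suc (Suc n)) * A (Suc n) t"
    by (simp only: of_nat_Suc[of "Suc n"] distrib_right mult_1)
  finally show ?case
    using Suc[of t] by (metis mult.left_commute power_Suc)
qed

text \<open>Up to null sets the cube splits into \<open>fact n\<close> simplices, one for each
  ordering of the variables. The proof applies the preceding lemma once per variable, each time
  gaining one factor of the factorial.\<close>

lemma tail_integral_power_eq_simplex_integral:
  assumes [measurable]: "f \<in> borel_measurable borel"
  shows "(\<integral>\<^sup>+s. f s * indicator {t<..} s \<partial>lborel) ^ n = fact n * simplex_integral f n t"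
proof (induction n arbitrary: t)
  case (Suc n)
  have "(\<integral>\<^sup>+s. f s * indicator {t<..} s \<partial>lborel) ^ Suc n = of_nat (Suc n) *
      (\<integral>\<^sup>+s. fact n * (f s * simplex_integral f n s * indicator {t<..} s) \<partial>lborel)"
    by (subst tail_integral_power_step[symmetric], simp, simp only: Suc)
      (simp only: ac_simps)
  then show ?case
    by (simp add: nn_integral_cmult mult.assoc)
qed simp

text \<open>Reduces real moments to integer ones. The summand 1 covers arguments up to 1; at
  infinity both sides are infinite, since \<open>0 < a \<le> real n\<close> forces \<open>n\<close>
  to be positive.\<close>

lemma ennreal_powr_le_power:
  assumes "0 < a" "a \<le> real n"
  shows "ennreal_powr x a \<le> 1 + x ^ n"
proof (cases x)
  case (real r)
  have "r powr a \<le> 1 + r ^ n"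
  proof (cases "r \<le> 1")
    case True
    then have "r powr a \<le> 1"
      using real assms by (simp add: powr_le1)
    then show ?thesis using real by (simp add: add_increasing2)
  next
    case False
    then have "r powr a \<le> r powr real n"
      using assms by (intro powr_mono) auto
    then show ?thesis using False by (simp add: powr_realpow)
  qed
  then show ?thesis
    using real by (simp add: ennreal_powr_def ennreal_power flip: ennreal_1 ennreal_plus)
next
  case top
  then show ?thesis
    using assms by (simp add: ennreal_powr_def power_top_ennreal)
qed

section \<open>Joint measurability of the process\<close>

context additive_process
begin

text \<open>By right-continuity the process is a pointwise limit of its values at grid points to the
  right of \<open>u\<close>, and each such approximation involves only countably many times.
  Clamping by \<open>max 0 u\<close> avoids negative times, where the process is
  unconstrained.\<close>

lemma measurable_process [measurable]:
  "(\<lambda>(u, \<omega>). X (max 0 u) \<omega>) \<in> borel_measurable (borel \<Otimes>\<^sub>M M)"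
proof (rule borel_measurable_LIMSEQ_metric)
  fix k :: nat
  have "(\<lambda>x. X (real (nat \<lfloor>real (Suc k) * max 0 (fst x)\<rfloor> + 1) / real (Suc k)) (snd x))
      \<in> borel_measurable (borel \<Otimes>\<^sub>M M)"
  proof (rule measurable_compose_countable[where
        f = "\<lambda>i x. X (real (i + 1) / real (Suc k)) (snd x)" and
        g = "\<lambda>x. nat \<lfloor>real (Suc k) * max 0 (fst x)\<rfloor>"])
    fix i :: nat
    have [measurable]: "X (real (i + 1) / real (Suc k)) \<in> borel_measurable M"
      by (rule process_measurable) simp
    show "(\<lambda>x. X (real (i + 1) / real (Suc k)) (snd x)) \<in> borel_measurable (borel \<Otimes>\<^sub>M M)"
      by measurable
  qed measurable
  then show "(\<lambda>(u, \<omega>). X (real (nat \<lfloor>real (Suc k) * max 0 u\<rfloor> + 1) / real (Suc k)) \<omega>)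
      \<in> borel_measurable (borel \<Otimes>\<^sub>M M)"
    by (simp add: case_prod_beta')
next
  fix x :: "real \<times> 'a" assume x: "x \<in> space (borel \<Otimes>\<^sub>M M)"
  obtain u0 \<omega> where [simp]: "x = (u0, \<omega>)" by (cases x)
  define u where "u = max 0 u0"
  \<comment> \<open>Adding 1 to the floor keeps \<open>a k\<close> strictly above \<open>u\<close>,
    as a limit along \<open>at_right u\<close> demands, and at distance at most the mesh.\<close>
  define a where "a k = real (nat \<lfloor>real (Suc k) * u\<rfloor> + 1) / real (Suc k)" for k
  have "0 \<le> u" by (simp add: u_def)
  have a_gt: "u < a k" and a_le: "a k \<le> u + inverse (real (Suc k))" for k
  proof -
    have *: "real (nat \<lfloor>real (Suc k) * u\<rfloor>) = of_int \<lfloor>real (Suc k) * u\<rfloor>"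
      using \<open>0 \<le> u\<close> by simp
    have "real (Suc k) * u < of_int \<lfloor>real (Suc k) * u\<rfloor> + 1"
      "of_int \<lfloor>real (Suc k) * u\<rfloor> \<le> real (Suc k) * u" by linarith+
    moreover have "real (Suc k) * a k = of_int \<lfloor>real (Suc k) * u\<rfloor> + 1"
      unfolding a_def of_nat_add * by simp
    moreover have "real (Suc k) * (u + inverse (real (Suc k))) = real (Suc k) * u + 1"
      unfolding distrib_left by simp
    ultimately have "real (Suc k) * u < real (Suc k) * a k"
      "real (Suc k) * a k \<le> real (Suc k) * (u + inverse (real (Suc k)))"
      by linarith+
    then show "u < a k" "a k \<le> u + inverse (real (Suc k))"
      by (simp_all del: of_nat_Suc)
  qed
  have "a \<longlonglongrightarrow> u"
  proof (rule tendsto_sandwich[OF _ _ tendsto_const])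
    show "(\<lambda>k. u + inverse (real (Suc k))) \<longlonglongrightarrow> u"
      using tendsto_add[OF tendsto_const LIMSEQ_inverse_real_of_nat, of u] by simp
  qed (use a_gt a_le less_imp_le in \<open>auto intro!: always_eventually\<close>)
  then have "filterlim a (at_right u) sequentially"
    using a_gt by (auto simp: filterlim_at less_imp_neq[symmetric])
  moreover have "((\<lambda>t. X t \<omega>) \<longlongrightarrow> X u \<omega>) (at_right u)"
    using cadlag_paths[of \<omega>] x \<open>0 \<le> u\<close>
    by (auto simp: cadlag_def space_pair_measure continuous_within)
  ultimately have "(\<lambda>k. X (a k) \<omega>) \<longlonglongrightarrow> X u \<omega>"
    by (rule filterlim_compose[rotated])
  then show "(\<lambda>k. (\<lambda>(u, \<omega>). X (real (nat \<lfloor>real (Suc k) * max 0 u\<rfloor> + 1) / real (Suc k)) \<omega>) x)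
      \<longlonglongrightarrow> (\<lambda>(u, \<omega>). X (max 0 u) \<omega>) x"
    by (simp add: a_def u_def)
qed

text \<open>The indicator silences the unconstrained negative times, so that joint measurability
  holds over the whole real line.\<close>

definition path_density :: "'a \<Rightarrow> real \<Rightarrow> ennreal" where
  "path_density \<omega> u = ennreal (exp (- X u \<omega>)) * indicator {0..} u"

lemma measurable_path_density [measurable]:
  "(\<lambda>(u, \<omega>). path_density \<omega> u) \<in> borel_measurable (borel \<Otimes>\<^sub>M M)"
proof -
  have "(\<lambda>(u, \<omega>). path_density \<omega> u) = (\<lambda>(u, \<omega>). ennreal (exp (- X (max 0 u) \<omega>)) * indicator {0..} u)"
    by (auto simp: path_density_def fun_eq_iff split: split_indicator)
  then show ?thesis by simp
qed

lemma measurable_path_density_section: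
  assumes "\<omega> \<in> space M"
  shows "path_density \<omega> \<in> borel_measurable borel"
  using measurable_compose[OF measurable_Pair2'[OF assms, of borel] measurable_path_density]
  by simp

section \<open>Laplace transforms weighted by past increments\<close>

text \<open>Values in \<open>ennreal\<close> let products and Fubini work without integrability side
  conditions.\<close>

definition laplace :: "real \<Rightarrow> real \<Rightarrow> ennreal" where
  "laplace t l = (\<integral>\<^sup>+\<omega>. ennreal (exp (- l * X t \<omega>)) \<partial>M)"

text \<open>The weight collected from times already chosen. Free coefficients allow a further
  exponential of the process to be absorbed by shifting them.\<close>

definition increment_prod :: "(nat \<Rightarrow> real) \<Rightarrow> (nat \<Rightarrow> real) \<Rightarrow> nat \<Rightarrow> 'a \<Rightarrow> ennreal" where
  "increment_prod \<tau> c m \<omega> = (\<Prod>k<m. ennreal (exp (- c k * (X (\<tau> (Suc k)) \<omega> - X (\<tau> k) \<omega>))))"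

definition partition :: "nat \<Rightarrow> (nat \<Rightarrow> real) \<Rightarrow> bool" where
  "partition m \<tau> \<longleftrightarrow> \<tau> 0 = 0 \<and> strict_mono_on {..m} \<tau>"

lemma partition_nonneg: "partition m \<tau> \<Longrightarrow> k \<le> m \<Longrightarrow> 0 \<le> \<tau> k"
  unfolding partition_def strict_mono_on_def
  by (metis atMost_iff bot_nat_0.extremum le_less less_eq_real_def)

lemma partition_extend:
  assumes "partition m \<tau>" "\<tau> m < s"
  shows "partition (Suc m) (\<tau>(Suc m := s))"
  unfolding partition_def
proof (intro conjI strict_mono_onI)
  fix i j assume ij: "i \<in> {..Suc m}" "j \<in> {..Suc m}" "i < j"
  have mono: "strict_mono_on {..m} \<tau>" using assms by (simp add: partition_def)
  show "(\<tau>(Suc m := s)) i < (\<tau>(Suc m := s)) j"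
  proof (cases "j = Suc m")
    case True
    then have "\<tau> i \<le> \<tau> m"
      using ij strict_mono_on_leD[OF mono, of i m] by simp
    then show ?thesis using True ij assms(2) by simp
  next
    case False
    then show ?thesis using ij strict_mono_onD[OF mono, of i j] by simp
  qed
qed (use assms in \<open>simp add: partition_def\<close>)

lemma measurable_increment_prod [measurable]:
  assumes "partition m \<tau>"
  shows "increment_prod \<tau> c m \<in> borel_measurable M"
proof -
  have "(\<lambda>\<omega>. ennreal (exp (- c k * (X (\<tau> (Suc k)) \<omega> - X (\<tau> k) \<omega>)))) \<in> borel_measurable M"
    if "k < m" for k
  proof -
    have [measurable]: "X (\<tau> k) \<in> borel_measurable M" "X (\<tau> (Suc k)) \<in> borel_measurable M"
      using that by (auto intro!: process_measurable partition_nonneg[OF assms])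
    show ?thesis by measurable
  qed
  then show ?thesis
    unfolding increment_prod_def by (intro borel_measurable_prod_ennreal) auto
qed

text \<open>Independence of the increments enters the argument here.\<close>

lemma nn_integral_increment_prod:
  assumes "partition m \<tau>"
  shows "(\<integral>\<^sup>+\<omega>. increment_prod \<tau> c m \<omega> \<partial>M) =
    (\<Prod>k<m. \<integral>\<^sup>+\<omega>. ennreal (exp (- c k * (X (\<tau> (Suc k)) \<omega> - X (\<tau> k) \<omega>))) \<partial>M)"
proof -
  have "indep_vars (\<lambda>_. borel) (\<lambda>k \<omega>. X (\<tau> (Suc k)) \<omega> - X (\<tau> k) \<omega>) {..<m}"
    using assms by (intro independent_increments) (auto simp: partition_def)
  then have "indep_vars (\<lambda>_. borel)
      (\<lambda>k \<omega>. ennreal (exp (- c k * (X (\<tau> (Suc k)) \<omega> - X (\<tau> k) \<omega>)))) {..<m}"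
    by (rule indep_vars_compose2[where Y = "\<lambda>k x. ennreal (exp (- c k * x))"]) measurable
  then show ?thesis
    unfolding increment_prod_def by (intro indep_vars_nn_integral) auto
qed

text \<open>\<open>X (\<tau> m)\<close> telescopes into the increments because the partition starts
  at 0 and \<open>X 0\<close> vanishes; the latter holds only almost surely, and so does the
  identity.\<close>

lemma increment_prod_mult_exp:
  assumes "partition m \<tau>"
  shows "AE \<omega> in M. increment_prod \<tau> c m \<omega> * ennreal (exp (- a * X (\<tau> m) \<omega>)) =
    increment_prod \<tau> (\<lambda>k. c k + a) m \<omega>"
  using start_zero
proof eventually_elim
  case (elim \<omega>)
  have "X (\<tau> m) \<omega> = (\<Sum>k<m. X (\<tau> (Suc k)) \<omega> - X (\<tau> k) \<omega>)"
    using elim assms sum_lessThan_telescope[of "\<lambda>k. X (\<tau> k) \<omega>" m] by (simp add: partition_def)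
  then have "exp (- a * X (\<tau> m) \<omega>) = (\<Prod>k<m. exp (- a * (X (\<tau> (Suc k)) \<omega> - X (\<tau> k) \<omega>)))"
    by (simp only: sum_distrib_left exp_sum[OF finite_lessThan])
  then show ?case
    unfolding increment_prod_def
    by (simp add: prod_ennreal ennreal_mult[symmetric] prod_nonneg prod.distrib[symmetric]
        exp_add[symmetric] algebra_simps)
qed

text \<open>A zero coefficient on the new increment lets an old weight be treated as one over the
  longer partition.\<close>

lemma increment_prod_extend:
  "increment_prod (\<tau>(Suc m := s)) (c(m := 0)) (Suc m) = increment_prod \<tau> c m"
  unfolding increment_prod_def by (auto simp: fun_eq_iff intro!: prod.cong)

text \<open>Absorbing \<open>exp (- a * X s \<omega>)\<close> into the weight over the extended
  partition gives the last increment the coefficient \<open>a\<close>; independence splits it off,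
  and the remaining product is folded back.\<close>

lemma laplace_factor:
  assumes "partition m \<tau>" "\<tau> m < s"
  shows "(\<integral>\<^sup>+\<omega>. increment_prod \<tau> c m \<omega> * ennreal (exp (- a * X s \<omega>)) \<partial>M) =
    (\<integral>\<^sup>+\<omega>. increment_prod \<tau> c m \<omega> * ennreal (exp (- a * X (\<tau> m) \<omega>)) \<partial>M) *
    (\<integral>\<^sup>+\<omega>. ennreal (exp (- a * (X s \<omega> - X (\<tau> m) \<omega>))) \<partial>M)"
proof -
  let ?\<tau> = "\<tau>(Suc m := s)" and ?c = "c(m := 0)"
  note part = partition_extend[OF assms]
  have "(\<integral>\<^sup>+\<omega>. increment_prod \<tau> c m \<omega> * ennreal (exp (- a * X s \<omega>)) \<partial>M) =
      (\<integral>\<^sup>+\<omega>. increment_prod ?\<tau> (\<lambda>k. ?c k + a) (Suc m) \<omega> \<partial>M)"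
    using increment_prod_mult_exp[OF part, of ?c a]
    by (intro nn_integral_cong_AE) (simp add: increment_prod_extend)
  also have "\<dots> = (\<Prod>k<m. \<integral>\<^sup>+\<omega>. ennreal (exp (- (c k + a) * (X (\<tau> (Suc k)) \<omega> - X (\<tau> k) \<omega>))) \<partial>M) *
      (\<integral>\<^sup>+\<omega>. ennreal (exp (- a * (X s \<omega> - X (\<tau> m) \<omega>))) \<partial>M)"
    unfolding nn_integral_increment_prod[OF part] by simp
  also have "(\<Prod>k<m. \<integral>\<^sup>+\<omega>. ennreal (exp (- (c k + a) * (X (\<tau> (Suc k)) \<omega> - X (\<tau> k) \<omega>))) \<partial>M) =
      (\<integral>\<^sup>+\<omega>. increment_prod \<tau> (\<lambda>k. c k + a) m \<omega> \<partial>M)"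
    unfolding nn_integral_increment_prod[OF assms(1)] ..
  also have "\<dots> = (\<integral>\<^sup>+\<omega>. increment_prod \<tau> c m \<omega> * ennreal (exp (- a * X (\<tau> m) \<omega>)) \<partial>M)"
    using increment_prod_mult_exp[OF assms(1), of c a]
    by (intro nn_integral_cong_AE) auto
  finally show ?thesis .
qed

text \<open>The increment factor in the preceding lemma depends on neither the partition before its
  last point nor the coefficients, so comparison with constant coefficients 0 eliminates it.\<close>

lemma laplace_cross_mult:
  assumes "partition m \<tau>" "\<tau> m < s"
  shows "(\<integral>\<^sup>+\<omega>. increment_prod \<tau> c m \<omega> * ennreal (exp (- a * X s \<omega>)) \<partial>M) * laplace (\<tau> m) a =
    (\<integral>\<^sup>+\<omega>. increment_prod \<tau> c m \<omega> * ennreal (exp (- a * X (\<tau> m) \<omega>)) \<partial>M) * laplace s a"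
proof -
  have one: "increment_prod \<tau> (\<lambda>_. 0) m \<omega> = 1" for \<omega>
    by (simp add: increment_prod_def)
  show ?thesis
    using laplace_factor[OF assms, of c a] laplace_factor[OF assms, of "\<lambda>_. 0" a]
    by (simp add: one laplace_def ac_simps)
qed

lemma measurable_laplace: "(\<lambda>s. laplace (max 0 s) l) \<in> borel_measurable borel"
proof -
  have "(\<lambda>(s, \<omega>). ennreal (exp (- l * X (max 0 s) \<omega>))) \<in> borel_measurable (borel \<Otimes>\<^sub>M M)"
    by measurable
  then show ?thesis
    unfolding laplace_def by (rule borel_measurable_nn_integral)
qed

section \<open>Bound for the expected ordered integral\<close>

text \<open>An arbitrary weight and starting time are needed for the induction: fixing the first
  integration time \<open>s\<close> multiplies the weight by \<open>exp (- X s \<omega>)\<close> and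
  makes \<open>s\<close> the new last partition point. The factor
  \<open>laplace (\<tau> m) (real n)\<close> stands on the left in place of a division on the
  right.\<close>

lemma simplex_integral_expectation_le:
  assumes fin: "\<And>t l. t \<ge> 0 \<Longrightarrow> l \<ge> 0 \<Longrightarrow> laplace t l \<noteq> \<infinity>"
    and pos: "\<And>t l. t \<ge> 0 \<Longrightarrow> l \<ge> 0 \<Longrightarrow> laplace t l \<noteq> 0"
    and "partition m \<tau>"
  shows "(\<integral>\<^sup>+\<omega>. increment_prod \<tau> c m \<omega> * simplex_integral (path_density \<omega>) n (\<tau> m) \<partial>M) *
      laplace (\<tau> m) (real n) \<le>
    (\<integral>\<^sup>+\<omega>. increment_prod \<tau> c m \<omega> * ennreal (exp (- real n * X (\<tau> m) \<omega>)) \<partial>M) *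
      (\<Prod>j<n. \<integral>\<^sup>+s\<in>{0..}. laplace s (real (Suc j)) / laplace s (real j) \<partial>lborel)"
  using assms(3)
proof (induction n arbitrary: m \<tau> c)
  case 0
  then show ?case by (simp add: laplace_def emeasure_space_1)
next
  case (Suc n)
  note [measurable] = measurable_increment_prod[OF Suc.prems] measurable_laplace
    measurable_simplex_integral_param[OF measurable_path_density]
  define t where "t = \<tau> m"
  define W where "W = increment_prod \<tau> c m"
  define C where "C = (\<Prod>j<n. \<integral>\<^sup>+s\<in>{0..}. laplace s (real (Suc j)) / laplace s (real j) \<partial>lborel)"
  define D where "D = (\<integral>\<^sup>+\<omega>. W \<omega> * ennreal (exp (- real (Suc n) * X t \<omega>)) \<partial>M)"
  define r where "r s = laplace s (real (Suc n)) / laplace s (real n)" for s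
  have [measurable]: "W \<in> borel_measurable M" by (simp add: W_def)
  have "0 \<le> t"
    using partition_nonneg[OF Suc.prems, of m] by (simp add: t_def)
  have r_ind: "(\<lambda>s. r s * indicator {0..} s) =
      (\<lambda>s. laplace (max 0 s) (real (Suc n)) / laplace (max 0 s) (real n) * indicator {0..} s)"
    by (auto simp: r_def fun_eq_iff split: split_indicator)
  have [measurable]: "(\<lambda>s. r s * indicator {0..} s) \<in> borel_measurable borel"
    unfolding r_ind by measurable
  have step: "(\<integral>\<^sup>+\<omega>. W \<omega> * (path_density \<omega> s * simplex_integral (path_density \<omega>) n s) \<partial>M) *
      laplace t (real (Suc n)) \<le> D * C * r s" (is "?E * _ \<le> _") if "t < s" for s
  proof -
    have "0 \<le> s" using that \<open>0 \<le> t\<close> by simp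
    note less = that[unfolded t_def]
    \<comment> \<open>The new increment gets coefficient 0 and then every coefficient rises by 1,
      which encodes \<open>W \<omega> * exp (- X s \<omega>)\<close>.\<close>
    let ?\<tau> = "\<tau>(Suc m := s)" and ?c = "\<lambda>k. (c(m := 0)) k + 1"
    note part = partition_extend[OF Suc.prems less]
    have W': "AE \<omega> in M. increment_prod ?\<tau> ?c (Suc m) \<omega> = W \<omega> * ennreal (exp (- X s \<omega>))"
      using increment_prod_mult_exp[OF part, of "c(m := 0)" 1]
      by eventually_elim (simp add: increment_prod_extend W_def)
    have E: "(\<integral>\<^sup>+\<omega>. increment_prod ?\<tau> ?c (Suc m) \<omega> * simplex_integral (path_density \<omega>) n s \<partial>M) = ?E"
      by (rule nn_integral_cong_AE, rule AE_mp[OF W'])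
        (use \<open>0 \<le> s\<close> in \<open>auto simp: path_density_def ac_simps\<close>)
    have E': "(\<integral>\<^sup>+\<omega>. increment_prod ?\<tau> ?c (Suc m) \<omega> * ennreal (exp (- real n * X s \<omega>)) \<partial>M) =
        (\<integral>\<^sup>+\<omega>. W \<omega> * ennreal (exp (- real (Suc n) * X s \<omega>)) \<partial>M)"
      by (rule nn_integral_cong_AE, rule AE_mp[OF W'])
        (auto simp: mult.assoc ennreal_mult[symmetric] exp_add[symmetric] algebra_simps)
    have "?E * laplace s (real n) \<le>
        (\<integral>\<^sup>+\<omega>. W \<omega> * ennreal (exp (- real (Suc n) * X s \<omega>)) \<partial>M) * C"
      using Suc.IH[OF part, of ?c] by (simp only: fun_upd_same E E' C_def)
    then have "?E * laplace s (real n) * laplace t (real (Suc n)) \<le>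
        (\<integral>\<^sup>+\<omega>. W \<omega> * ennreal (exp (- real (Suc n) * X s \<omega>)) \<partial>M) * C * laplace t (real (Suc n))"
      by (rule mult_right_mono) simp
    \<comment> \<open>Cross multiplication moves the weighted expectation from time \<open>s\<close>
      back to \<open>t\<close>, exchanging the Laplace factor at \<open>t\<close> for the one at
      \<open>s\<close>.\<close>
    also have "\<dots> = D * laplace s (real (Suc n)) * C"
      using laplace_cross_mult[OF Suc.prems less, of c "real (Suc n)"]
      unfolding D_def W_def t_def by (simp only: mult.commute mult.left_commute)
    \<comment> \<open>Dividing by \<open>laplace s (real n)\<close>, which is finite and nonzero,
      produces the ratio \<open>r s\<close>.\<close>
    finally have "?E * laplace t (real (Suc n)) * laplace s (real n) / laplace s (real n) \<le>
        D * C * laplace s (real (Suc n)) / laplace s (real n)"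
      by (intro divide_right_mono_ennreal) (simp only: ac_simps)
    then show ?thesis
      using fin[OF \<open>0 \<le> s\<close>, of "real n"] pos[OF \<open>0 \<le> s\<close>, of "real n"]
      by (simp add: ennreal_mult_divide_eq r_def ennreal_times_divide)
  qed
  have "(\<integral>\<^sup>+\<omega>. W \<omega> * simplex_integral (path_density \<omega>) (Suc n) t \<partial>M) =
      (\<integral>\<^sup>+\<omega>. \<integral>\<^sup>+s. W \<omega> * (path_density \<omega> s * simplex_integral (path_density \<omega>) n s) *
        indicator {t<..} s \<partial>lborel \<partial>M)"
  proof (rule nn_integral_cong)
    fix \<omega> assume "\<omega> \<in> space M"
    have [measurable]: "path_density \<omega> \<in> borel_measurable borel"
      by (rule measurable_path_density_section) fact
    show "W \<omega> * simplex_integral (path_density \<omega>) (Suc n) t =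
      (\<integral>\<^sup>+s. W \<omega> * (path_density \<omega> s * simplex_integral (path_density \<omega>) n s) *
        indicator {t<..} s \<partial>lborel)"
      by (simp add: nn_integral_cmult mult.assoc)
  qed
  also have "\<dots> = (\<integral>\<^sup>+s. \<integral>\<^sup>+\<omega>. W \<omega> * (path_density \<omega> s * simplex_integral (path_density \<omega>) n s) *
        indicator {t<..} s \<partial>M \<partial>lborel)"
  proof -
    interpret P: pair_sigma_finite lborel M ..
    show ?thesis
      by (rule P.Fubini') measurable
  qed
  finally have "(\<integral>\<^sup>+\<omega>. W \<omega> * simplex_integral (path_density \<omega>) (Suc n) t \<partial>M) *
      laplace t (real (Suc n)) =
      (\<integral>\<^sup>+s. (\<integral>\<^sup>+\<omega>. W \<omega> * (path_density \<omega> s * simplex_integral (path_density \<omega>) n s) *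
        indicator {t<..} s \<partial>M) * laplace t (real (Suc n)) \<partial>lborel)"
    by (simp add: nn_integral_multc)
  \<comment> \<open>Enlarging \<open>t < s\<close> to \<open>0 \<le> s\<close> drops the ordering
    constraint; all dependence on \<open>s\<close> now sits in the deterministic ratio.\<close>
  also have "\<dots> \<le> (\<integral>\<^sup>+s. D * C * (r s * indicator {0..} s) \<partial>lborel)"
  proof (rule nn_integral_mono)
    fix s :: real
    show "(\<integral>\<^sup>+\<omega>. W \<omega> * (path_density \<omega> s * simplex_integral (path_density \<omega>) n s) *
        indicator {t<..} s \<partial>M) * laplace t (real (Suc n)) \<le> D * C * (r s * indicator {0..} s)"
      using step[of s] \<open>0 \<le> t\<close> by (cases "t < s") auto
  qed
  also have "\<dots> = D * (C * (\<integral>\<^sup>+s\<in>{0..}. r s \<partial>lborel))"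
    by (simp add: nn_integral_cmult mult.assoc)
  finally show ?case
    unfolding D_def W_def C_def t_def r_def prod.lessThan_Suc .
qed

section \<open>From Laplace exponents to moments\<close>

text \<open>A strictly positive integrable variable on a probability space has strictly positive
  expectation, so the exponential inverts the logarithm.\<close>

lemma laplace_eq_exp_laplace_exponent:
  assumes "integrable M (\<lambda>\<omega>. exp (- l * X t \<omega>))"
  shows "laplace t l = ennreal (exp (- laplace_exponent M X t l))"
proof -
  have eq: "laplace t l = ennreal (\<integral>\<omega>. exp (- l * X t \<omega>) \<partial>M)"
    unfolding laplace_def using assms by (intro nn_integral_eq_integral) auto
  have "(\<integral>\<omega>. exp (- l * X t \<omega>) \<partial>M) \<noteq> 0"
    using assms by (subst integral_nonneg_eq_0_iff_AE) (auto simp: AE_False)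
  then have "0 < (\<integral>\<omega>. exp (- l * X t \<omega>) \<partial>M)"
    by (simp add: less_le)
  then show ?thesis
    by (simp add: eq laplace_exponent_def)
qed

lemma exp_functional_power_eq:
  assumes "\<omega> \<in> space M"
  shows "exp_functional X \<omega> ^ n = fact n * simplex_integral (path_density \<omega>) n 0"
proof -
  have [measurable]: "path_density \<omega> \<in> borel_measurable borel"
    using assms by (rule measurable_path_density_section)
  \<comment> \<open>The closed and the open half-line differ by the null set containing only
    0.\<close>
  have "exp_functional X \<omega> = (\<integral>\<^sup>+s. path_density \<omega> s * indicator {0<..} s \<partial>lborel)"
    unfolding exp_functional_def path_density_def
    by (rule nn_integral_cong_AE, rule AE_mp[OF AE_lborel_singleton[of 0]])
      (auto split: split_indicator)
  then show ?thesis
    by (simp add: tail_integral_power_eq_simplex_integral)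
qed

end

theorem corollary2p6:
  fixes M :: "'a measure" and X :: "real \<Rightarrow> 'a \<Rightarrow> real"
  assumes "additive_process M X"
    and "\<And>t l. \<lbrakk>t \<ge> 0; l \<ge> 0\<rbrakk> \<Longrightarrow> integrable M (\<lambda>\<omega>. exp (- l * X t \<omega>))"
    and "\<And>n::nat. n \<ge> 1 \<Longrightarrow>
      (\<integral>\<^sup>+s\<in>{0..}. ennreal (exp (- (laplace_exponent M X s (real n)
                                     - laplace_exponent M X s (real n - 1)))) \<partial>lborel) < \<infinity>"
  shows "\<forall>\<alpha>>0. (\<integral>\<^sup>+\<omega>. ennreal_powr (exp_functional X \<omega>) \<alpha> \<partial>M) < \<infinity>"
proof (intro allI impI)
  fix \<alpha> :: real assume "0 < \<alpha>"
  interpret additive_process M X by fact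
  note lap = laplace_eq_exp_laplace_exponent[OF assms(2)]
  define n where "n = nat \<lceil>\<alpha>\<rceil>"
  have n: "\<alpha> \<le> real n" unfolding n_def by linarith
  let ?R = "\<lambda>\<omega>. simplex_integral (path_density \<omega>) n 0"
  have R_meas: "?R \<in> borel_measurable M"
    using measurable_compose[OF measurable_Pair1'[of 0 borel M]
        measurable_simplex_integral_param[OF measurable_path_density, of n]] by simp
  \<comment> \<open>The quotient is the integrand of the hypothesis at index \<open>Suc j\<close>,
    so the indices start at 1.\<close>
  have "(\<integral>\<^sup>+s\<in>{0..}. laplace s (real (Suc j)) / laplace s (real j) \<partial>lborel) < \<infinity>" for j
  proof -
    have "(\<integral>\<^sup>+s\<in>{0..}. laplace s (real (Suc j)) / laplace s (real j) \<partial>lborel) =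
      (\<integral>\<^sup>+s\<in>{0..}. ennreal (exp (- (laplace_exponent M X s (real (Suc j))
         - laplace_exponent M X s (real (Suc j) - 1)))) \<partial>lborel)"
      by (intro nn_integral_cong)
        (auto simp: lap divide_ennreal exp_diff[symmetric] split: split_indicator)
    then show ?thesis using assms(3)[of "Suc j"] by simp
  qed
  then have prod_fin: "(\<Prod>j<n. \<integral>\<^sup>+s\<in>{0..}. laplace s (real (Suc j)) / laplace s (real j) \<partial>lborel) < \<infinity>"
    by (simp add: ennreal_prod_eq_top less_top[symmetric])
  have start: "(\<integral>\<^sup>+\<omega>. ennreal (exp (- real n * X 0 \<omega>)) \<partial>M) = 1"
  proof -
    have "(\<integral>\<^sup>+\<omega>. ennreal (exp (- real n * X 0 \<omega>)) \<partial>M) = (\<integral>\<^sup>+\<omega>. 1 \<partial>M)"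
      using start_zero by (intro nn_integral_cong_AE) auto
    then show ?thesis by (simp add: emeasure_space_1)
  qed
  have "(\<integral>\<^sup>+\<omega>. ?R \<omega> \<partial>M) \<le>
      (\<Prod>j<n. \<integral>\<^sup>+s\<in>{0..}. laplace s (real (Suc j)) / laplace s (real j) \<partial>lborel)"
  proof -
    have finpos: "laplace t l \<noteq> \<infinity>" "laplace t l \<noteq> 0" if "t \<ge> 0" "l \<ge> 0" for t l
      using lap[OF that] by simp_all
    \<comment> \<open>For the one-point partition at time 0 the weight is an empty product, and both
      Laplace factors at time 0 equal 1.\<close>
    have "partition 0 (\<lambda>_. 0)"
      by (auto simp: partition_def strict_mono_on_def)
    moreover have "laplace 0 (real n) = 1"
      using start by (simp only: laplace_def)
    ultimately show ?thesis
      using simplex_integral_expectation_le[OF finpos, of 0 "\<lambda>_. 0" "\<lambda>_. 0" n] start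
      by (simp add: increment_prod_def del: of_nat_Suc)
  qed
  then have R_fin: "(\<integral>\<^sup>+\<omega>. ?R \<omega> \<partial>M) < \<infinity>"
    using prod_fin by (rule le_less_trans)
  have "(\<integral>\<^sup>+\<omega>. ennreal_powr (exp_functional X \<omega>) \<alpha> \<partial>M) \<le> (\<integral>\<^sup>+\<omega>. 1 + fact n * ?R \<omega> \<partial>M)"
    using ennreal_powr_le_power[OF \<open>0 < \<alpha>\<close> n]
    by (intro nn_integral_mono) (simp add: exp_functional_power_eq[symmetric])
  also have "\<dots> = 1 + fact n * (\<integral>\<^sup>+\<omega>. ?R \<omega> \<partial>M)"
    using R_meas by (simp add: nn_integral_add nn_integral_cmult emeasure_space_1)
  also have "\<dots> < \<infinity>"
  proof -
    have "(fact n :: ennreal) = of_nat (fact n)" by simp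
    then have "(fact n :: ennreal) < \<infinity>"
      by (metis infinity_ennreal_def of_nat_less_top)
    then show ?thesis
      using R_fin by (simp add: ennreal_mult_less_top)
  qed
  finally show "(\<integral>\<^sup>+\<omega>. ennreal_powr (exp_functional X \<omega>) \<alpha> \<partial>M) < \<infinity>" .
qed

end
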